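(* Let $A$, $B$ and $C$ be matrices in $\mathbb{C}^{d\times d}$, with $C+kI$ invertible for all integers $k\ge0$. Then the Horn matrix function $H_5(A,B;C;x,y)$ satisfies the following infinite summation formulae for $|t|<1$: (1) $(1-t)^{-A}\,H_5\!\left(A,B;C;\frac{x}{(1-t)^2},\frac{y}{1-t}\right)=\sum_{n=0}^{\infty}\frac{(A)_n}{n!}\,H_5(A+nI,B;C;x,y)\,t^n$; (2) if $AB=BA$, $(1-t)^{-B}\,H_5\!\left(A,B;C;x(1-t),\frac{y}{1-t}\right)=\sum_{n=0}^{\infty}\frac{(B)_n}{n!}\,H_5(A,B+nI;C;x,y)\,t^n$.
   Context: $H_5(A,B;C;x,y)=\sum_{m,n=0}^{\infty}(A)_{2m+n}(B)_{n-m}(C)_n^{-1}\frac{x^m y^n}{m!\,n!}$. Matrix Pochhammer symbol: for $M\in\mathbb{C}^{d\times d}$, $(M)_0=I$, $(M)_n=M(M+I)\cdots(M+(n-1)I)$ for $n\ge1$, and $(M)_{-n}=(-1)^n(I-M)_n^{-1}$; $(M)_n^{-1}$ is the inverse matrix of $(M)_n$. For $|t|<1$, $(1-t)^{-M}=\sum_{n\ge0}\frac{(M)_n}{n!}t^n$.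
   Formalization: Also assumed: B−kI invertible (k≥1), in (2) B+kI invertible (k≥0); all points lie inside the region of absolute convergence of H_5. The right series is shown to converge only if the left points stay there for all |s|≤|t|; otherwise equality is shown whenever it converges. *)

theory Defs
  imports "HOL-Analysis.Analysis"
begin

text \<open>
  Matrices in \<open>\<complex>\<^sup>d\<^sup>\<times>\<^sup>d\<close> are \<open>complex^'d^'d\<close>; \<open>mat c\<close> is \<open>c\<cdot>I\<close>. The library has no multiplication
  of a matrix by a complex scalar (\<open>*s\<close> acts on vectors only, \<open>*\<^sub>R\<close> is real).
\<close>

definition cscale :: "complex \<Rightarrow> complex^'d^'d \<Rightarrow> complex^'d^'d"  (infixr "\<star>" 75) where
  "c \<star> M = (\<chi> i j. c * M $ i $ j)"

primrec poch_nat :: "complex^'d^'d \<Rightarrow> nat \<Rightarrow> complex^'d^'d" where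
  "poch_nat M 0 = mat 1"
| "poch_nat M (Suc n) = poch_nat M n ** (M + mat (of_nat n))"

text \<open>
  For \<open>k = -n < 0\<close> this is \<open>(-1)\<^sup>n (I - M)\<^sub>n\<^sup>-\<^sup>1\<close>. It is meaningful only if \<open>(I - M)\<^sub>n\<close> is invertible,
  that is, if \<open>M - jI\<close> is invertible for \<open>1 \<le> j \<le> n\<close>: \<open>matrix_inv\<close> of a singular matrix is
  unspecified.
\<close>

definition poch :: "complex^'d^'d \<Rightarrow> int \<Rightarrow> complex^'d^'d" where
  "poch M k =
     (if k \<ge> 0 then poch_nat M (nat k)
      else (-1) ^ nat (- k) \<star> matrix_inv (poch_nat (mat 1 - M) (nat (- k))))"

definition horn_H5_term ::
  "complex^'d^'d \<Rightarrow> complex^'d^'d \<Rightarrow> complex^'d^'d \<Rightarrow> complex \<Rightarrow> complex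
     \<Rightarrow> nat \<Rightarrow> nat \<Rightarrow> complex^'d^'d" where
  "horn_H5_term A B C x y m n =
     (x ^ m * y ^ n / (fact m * fact n)) \<star>
       (poch A (2 * int m + int n) ** poch B (int n - int m) ** matrix_inv (poch C (int n)))"

definition horn_H5 ::
  "complex^'d^'d \<Rightarrow> complex^'d^'d \<Rightarrow> complex^'d^'d \<Rightarrow> complex \<Rightarrow> complex \<Rightarrow> complex^'d^'d" where
  "horn_H5 A B C x y = (\<Sum>\<^sub>\<infinity>(m, n)\<in>UNIV. horn_H5_term A B C x y m n)"

text \<open>
  The domain of convergence of the double power series, in the usual sense of several complex
  variables: the interior of the set of points at which it converges absolutely. Outside its closure
  \<open>horn_H5\<close> has no meaning.
\<close>

definition H5_domain ::
  "complex^'d^'d \<Rightarrow> complex^'d^'d \<Rightarrow> complex^'d^'d \<Rightarrow> (complex \<times> complex) set" where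
  "H5_domain A B C =
     interior {(x, y). (\<lambda>(m, n). norm (horn_H5_term A B C x y m n)) summable_on UNIV}"

text \<open>The power \<open>(1 - t)\<^sup>-\<^sup>M\<close>, given by its binomial series; for \<open>\<bar>t\<bar> < 1\<close> only.\<close>

definition one_minus_powr_neg :: "complex \<Rightarrow> complex^'d^'d \<Rightarrow> complex^'d^'d" where
  "one_minus_powr_neg t M = (\<Sum>n. (t ^ n / fact n) \<star> poch M (int n))"

end

theory Submission
  imports Defs "HOL-Complex_Analysis.Complex_Analysis"
begin

text \<open>
  Both formulae are instances of one resummation. Along the curve
  \<open>v \<mapsto> (x v\<^sup>a, y v\<^sup>b)\<close> with \<open>(a, b) = (-2, -1)\<close> or \<open>(a, b) = (1, -1)\<close>, the double series
  becomes a Laurent series \<open>H\<^sub>5 = (\<Sum>i. v\<^sup>e\<^sup>(\<^sup>i\<^sup>) W\<^sub>i)\<close>, where \<open>i = (m, n)\<close>, \<open>e(i) = a m + b n\<close> and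
  \<open>W\<^sub>i\<close> is the term of the series at \<open>(x, y)\<close>. Put \<open>v = 1 - s\<close> and multiply by \<open>(1 - s)\<^sup>-\<^sup>P\<close>, with
  \<open>P = A\<close> or \<open>P = B\<close>. Since \<open>(1 - s)\<^sup>e (1 - s)\<^sup>-\<^sup>P = (1 - s)\<^sup>-\<^sup>(\<^sup>P\<^sup>-\<^sup>e\<^sup>)\<close>
  (\<open>one_minus_powr_neg_diff_int\<close>), the result is

    \<open>F(s) = (\<Sum>i. (1 - s)\<^sup>-\<^sup>(\<^sup>P\<^sup>-\<^sup>e\<^sup>(\<^sup>i\<^sup>)\<^sup>) W\<^sub>i)\<close>,

  whose \<open>k\<close>-th Taylor coefficient at \<open>0\<close> is \<open>(\<Sum>i. (P - e(i))\<^sub>k W\<^sub>i) / k!\<close>. The Pochhammer identities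
  \<open>horn_H5_term_shift_A\<close> and \<open>horn_H5_term_shift_B\<close> turn this into \<open>(P)\<^sub>k / k!\<close> times \<open>H\<^sub>5\<close> with \<open>P\<close>
  replaced by \<open>P + k I\<close>. So the right-hand side is the Taylor series of the left-hand side, and
  what has to be shown is that this series represents \<open>F\<close> at \<open>t\<close>.

  Because the domain of convergence is open, absolute convergence at \<open>v = 1\<close> and \<open>v = 1 - t\<close>
  gives radii \<open>\<rho>\<^sub>1 < 1 < \<rho>\<^sub>2\<close> with \<open>\<rho>\<^sub>1 < \<bar>1 - t\<bar> < \<rho>\<^sub>2\<close> at which the Laurent series still
  converges absolutely. Hence \<open>F\<close> is holomorphic where \<open>\<rho>\<^sub>1 < \<bar>1 - s\<bar> < \<rho>\<^sub>2\<close> inside the unit disc.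
  If the whole curve over \<open>\<bar>s\<bar> \<le> \<bar>t\<bar>\<close> lies in the domain, the radii can be chosen such that this
  region contains a disc around \<open>0\<close> of radius larger than \<open>\<bar>t\<bar>\<close>, and Taylor's theorem gives the formula. In general the region need not
  contain the disc \<open>\<bar>s\<bar> < \<bar>t\<bar>\<close>; but if the Taylor series converges at \<open>t\<close>, it is holomorphic in that
  disc, it agrees with \<open>F\<close> along a path from \<open>0\<close> to \<open>t\<close> on which \<open>\<bar>1 - s\<bar>\<close> stays between \<open>1\<close> and
  \<open>\<bar>1 - t\<bar>\<close> (\<open>path_between_moduli\<close>), and Abel's limit theorem identifies the two values at the
  boundary point \<open>t\<close> (\<open>power_series_sum_at_boundary\<close>).
\<close>

(* The dollar sign denotes matrix entries throughout, never coefficients of formal power series. *)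
unbundle no fps_syntax

section \<open>Scalars and products of complex matrices\<close>

lemma cscale_nth [simp]: "(c \<star> M) $ i $ j = c * M $ i $ j"
  by (simp add: cscale_def)

lemma norm_cscale: "norm (c \<star> M) = norm c * norm M"
  by (simp add: norm_vec_def cscale_def norm_mult L2_set_right_distrib)

lemma cscale_cscale: "c \<star> d \<star> M = (c * d) \<star> M"
  by (simp add: vec_eq_iff)

lemma cscale_one [simp]: "1 \<star> M = M"
  by (simp add: vec_eq_iff)

lemma cscale_mult_left: "(c \<star> M) ** N = c \<star> (M ** N)"
  by (simp add: vec_eq_iff matrix_matrix_mult_def sum_distrib_left mult.assoc)

lemma cscale_mult_right: "M ** (c \<star> N) = c \<star> (M ** N)"
  by (simp add: vec_eq_iff matrix_matrix_mult_def sum_distrib_left mult.left_commute)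

lemma bounded_linear_cscale: "bounded_linear (\<lambda>M :: complex^'d^'d. c \<star> M)"
proof -
  have "linear (\<lambda>M :: complex^'d^'d. c \<star> M)"
    by (rule linearI) (simp_all add: vec_eq_iff algebra_simps)
  then show ?thesis
    by (simp add: linear_conv_bounded_linear)
qed

lemma bounded_bilinear_matrix_mult:
  "bounded_bilinear (\<lambda>M N :: complex^'d^'d. M ** N)"
proof -
  have "bilinear (\<lambda>M N :: complex^'d^'d. M ** N)"
    unfolding bilinear_def
    by (auto intro!: linearI
        simp: vec_eq_iff matrix_matrix_mult_def algebra_simps sum.distrib scaleR_sum_right)
  then show ?thesis
    by (simp add: bilinear_conv_bounded_bilinear)
qed

lemmas bounded_linear_matrix_mult_left = bounded_bilinear.bounded_linear_left [OF bounded_bilinear_matrix_mult]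
lemmas bounded_linear_matrix_mult_right = bounded_bilinear.bounded_linear_right [OF bounded_bilinear_matrix_mult]

lemma bounded_linear_entry: "bounded_linear (\<lambda>M :: complex^'d^'d. M $ p $ q)"
  by (rule bounded_linear_compose[OF bounded_linear_vec_nth bounded_linear_vec_nth])

lemma mat_add: "mat a + mat b = (mat (a + b) :: complex^'d^'d)"
  by (simp add: vec_eq_iff mat_def)

lemma mat_mult_left: "mat c ** M = c \<star> M"
  by (simp add: vec_eq_iff matrix_matrix_mult_def mat_def if_distrib[of "\<lambda>x. x * _"] cong: if_cong)

lemma mat_mult_right: "M ** mat c = c \<star> M"
  by (simp add: vec_eq_iff matrix_matrix_mult_def mat_def if_distrib[of "\<lambda>x. _ * x"] cong: if_cong)

lemma matrix_inv_eqI: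
  fixes M N :: "complex^'d^'d"
  assumes "M ** N = mat 1"
  shows "matrix_inv M = N"
proof -
  have NM: "N ** M = mat 1"
    using assms by (simp add: matrix_left_right_inverse)
  have "M ** matrix_inv M = mat 1 \<and> matrix_inv M ** M = mat 1"
    unfolding matrix_inv_def by (rule someI[of _ N]) (use assms NM in auto)
  then have "N = N ** (M ** matrix_inv M)"
    by simp
  also have "\<dots> = matrix_inv M"
    by (simp add: matrix_mul_assoc NM)
  finally show ?thesis ..
qed

section \<open>Matrix Pochhammer symbols\<close>

lemma poch_of_nat [simp]: "poch M (int n) = poch_nat M n"
  by (simp add: poch_def)

lemma commute_shift:
  fixes M N :: "complex^'d^'d"
  assumes "M ** N = N ** M"
  shows "(M + mat c) ** N = N ** (M + mat c)"
  using assms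
  by (simp add: bounded_bilinear.add_left[OF bounded_bilinear_matrix_mult] matrix_add_ldistrib
      mat_mult_left mat_mult_right)

lemma poch_nat_commute:
  fixes M N :: "complex^'d^'d"
  assumes "M ** N = N ** M"
  shows "poch_nat M n ** N = N ** poch_nat M n"
proof (induction n)
  case (Suc n)
  have "poch_nat M n ** (M + mat (of_nat n)) ** N = poch_nat M n ** N ** (M + mat (of_nat n))"
    by (simp add: commute_shift[OF assms] flip: matrix_mul_assoc)
  then show ?case
    by (simp add: Suc.IH matrix_mul_assoc)
qed simp

lemma poch_nat_add:
  "poch_nat M (m + n) = poch_nat M m ** poch_nat (M + mat (of_nat m)) n"
  by (induction n) (simp_all add: matrix_mul_assoc add.assoc mat_add)

text \<open>Both sides are \<open>(M)\<^sub>m\<^sub>+\<^sub>n\<close>: all factors are polynomials in \<open>M\<close> and commute.\<close>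
lemma poch_nat_swap:
  "poch_nat (M + mat (of_nat m)) n ** poch_nat M m
     = poch_nat M n ** poch_nat (M + mat (of_nat n)) m"
proof -
  have "poch_nat (M + mat (of_nat m)) n ** poch_nat M m
      = poch_nat M m ** poch_nat (M + mat (of_nat m)) n"
    by (intro poch_nat_commute commute_shift poch_nat_commute[symmetric] refl)
  then show ?thesis
    by (simp add: add.commute flip: poch_nat_add)
qed

lemma poch_nat_pred:
  "poch_nat (M - mat 1) (Suc n) = (M - mat 1) ** poch_nat M n"
  using poch_nat_add[of "M - mat 1" 1 n] by simp

text \<open>
  The factors \<open>I - M, 2I - M, \<dots>, nI - M\<close> are, up to sign and in reverse order, those of
  \<open>(M - nI)\<^sub>n\<close>. This replaces the definition of \<open>(M)\<^sub>-\<^sub>n\<close> by the inverse of \<open>(M - nI)\<^sub>n\<close>, in which no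
  sign occurs and the addition law can be used.
\<close>
lemma poch_nat_reflect:
  "poch_nat (mat 1 - M) n = (-1) ^ n \<star> poch_nat (M - mat (of_nat n)) n"
proof (induction n)
  case (Suc n)
  let ?N = "M - mat (of_nat n)"
  have eq: "?N - mat 1 = M - mat (of_nat (Suc n))"
    by (simp add: vec_eq_iff mat_def)
  have shift: "?N - mat 1 = ?N + mat (- 1)"
    by (simp add: vec_eq_iff mat_def)
  have comm: "poch_nat ?N n ** (?N - mat 1) = (?N - mat 1) ** poch_nat ?N n"
    unfolding shift by (intro poch_nat_commute commute_shift[symmetric] refl)
  have "mat 1 - M + mat (of_nat n) = (-1) \<star> (?N - mat 1)"
    by (simp add: vec_eq_iff mat_def)
  then have "poch_nat (mat 1 - M) (Suc n)
      = (-1) ^ Suc n \<star> (poch_nat ?N n ** (?N - mat 1))"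
    by (simp add: Suc.IH cscale_mult_left cscale_mult_right cscale_cscale)
  also have "\<dots> = (-1) ^ Suc n \<star> poch_nat (?N - mat 1) (Suc n)"
    by (simp only: comm poch_nat_pred)
  finally show ?case
    by (simp only: eq)
qed (simp add: vec_eq_iff)

lemma invertible_poch_nat:
  fixes M :: "complex^'d^'d"
  assumes "\<And>i. i < n \<Longrightarrow> invertible (M + mat (of_nat i))"
  shows "invertible (poch_nat M n)"
  using assms
proof (induction n)
  case 0
  then show ?case by (auto simp: invertible_def intro: exI[of _ "mat 1"])
qed (simp add: invertible_mult)

lemma poch_minus_right_inverse:
  fixes M :: "complex^'d^'d"
  assumes "\<And>i. 1 \<le> i \<Longrightarrow> i \<le> n \<Longrightarrow> invertible (M - mat (of_nat i))"
  shows "poch_nat (M - mat (of_nat n)) n ** poch M (- int n) = mat 1"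
proof -
  let ?L = "poch_nat (M - mat (of_nat n)) n"
  have "invertible ?L"
  proof (rule invertible_poch_nat)
    fix i assume "i < n"
    then have "M - mat (of_nat n) + mat (of_nat i) = M - mat (of_nat (n - i))"
      by (simp add: vec_eq_iff mat_def)
    moreover have "invertible (M - mat (of_nat (n - i)))"
      using assms[of "n - i"] \<open>i < n\<close> by simp
    ultimately show "invertible (M - mat (of_nat n) + mat (of_nat i))"
      by (simp only:)
  qed
  then obtain X where X: "?L ** X = mat 1"
    by (auto simp: invertible_def)
  have "poch M (- int n) = X"
  proof (cases "n = 0")
    case True
    then show ?thesis using X by (simp add: poch_def)
  next
    case False
    have "matrix_inv (poch_nat (mat 1 - M) n) = (-1) ^ n \<star> X"
      by (rule matrix_inv_eqI)
        (simp add: poch_nat_reflect cscale_mult_left cscale_mult_right cscale_cscale X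
          flip: power_mult_distrib)
    then show ?thesis
      using False by (simp add: poch_def cscale_cscale flip: power_mult_distrib)
  qed
  then show ?thesis using X by simp
qed

text \<open>
  Both sides are \<open>(M)\<^sub>j\<^sub>+\<^sub>k\<close>. For \<open>j = -l < 0\<close> the symbols of index \<open>j\<close> are inverses of
  \<open>L = (M - l)\<^sub>l\<close> and \<open>L' = (M - l + k)\<^sub>l\<close>, and the claim \<open>(M - l)\<^sub>k L\<^sup>-\<^sup>1 = (M)\<^sub>k L'\<^sup>-\<^sup>1\<close> is
  \<open>(M - l)\<^sub>k L' = (M)\<^sub>k L\<close>, an instance of the law for natural indices. The factors of \<open>L'\<close> can lie on
  both sides of \<open>M\<close>, so shifts in both directions have to be invertible.
\<close>
lemma poch_swap:
  fixes M :: "complex^'d^'d"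
  assumes below: "\<And>i. i \<ge> 1 \<Longrightarrow> invertible (M - mat (of_nat i))"
    and above: "\<And>i. invertible (M + mat (of_nat i))"
  shows "poch_nat (M + mat (of_int j)) k ** poch M j = poch_nat M k ** poch (M + mat (of_nat k)) j"
proof (cases "j \<ge> 0")
  case True
  then obtain n where "j = int n"
    using nonneg_int_cases by blast
  then show ?thesis
    using poch_nat_swap[of M n k] by simp
next
  case False
  then obtain l where j: "j = - int l"
    by (metis int_cases3 linorder_not_le zero_less_imp_eq_int neg_le_0_iff_le of_nat_0_le_iff)
  define D where "D = M - mat (of_nat l)"
  define L where "L = poch_nat D l"
  define L' where "L' = poch_nat (D + mat (of_nat k)) l"
  define X where "X = poch M j"
  define X' where "X' = poch (M + mat (of_nat k)) j"
  have LX: "L ** X = mat 1"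
    unfolding L_def X_def D_def j by (rule poch_minus_right_inverse) (use below in auto)
  have D_k: "M + mat (of_nat k) - mat (of_nat l) = D + mat (of_nat k)"
    by (simp add: D_def)
  have LX': "L' ** X' = mat 1"
    unfolding L'_def X'_def D_k[symmetric] j
  proof (rule poch_minus_right_inverse)
    fix i :: nat
    show "invertible (M + mat (of_nat k) - mat (of_nat i))"
    proof (cases "i \<le> k")
      case True
      then have "M + mat (of_nat k) - mat (of_nat i) = M + mat (of_nat (k - i))"
        by (simp add: vec_eq_iff mat_def)
      then show ?thesis using above[of "k - i"] by (simp only:)
    next
      case False
      then have "M + mat (of_nat k) - mat (of_nat i) = M - mat (of_nat (i - k))"
        by (simp add: vec_eq_iff mat_def)
      moreover have "invertible (M - mat (of_nat (i - k)))"
        using below[of "i - k"] False by simp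
      ultimately show ?thesis by (simp only:)
    qed
  qed
  have DL: "M = D + mat (of_nat l)"
    by (simp add: D_def)
  have swap: "poch_nat M k ** L = poch_nat D k ** L'"
    unfolding L_def L'_def DL by (rule poch_nat_swap)
  have comm: "poch_nat D k ** L' = L' ** poch_nat D k" for k
    unfolding L'_def by (intro poch_nat_commute poch_nat_commute[symmetric] commute_shift[symmetric] refl)
  have commL: "L ** L' = L' ** L"
    unfolding L_def using comm .
  have X'L': "X' ** L' = mat 1"
    using LX' by (simp add: matrix_left_right_inverse)
  have "L ** X' = X' ** (L' ** L) ** X'"
    by (simp add: matrix_mul_assoc X'L')
  also have "\<dots> = X' ** L ** (L' ** X')"
    by (simp add: matrix_mul_assoc flip: commL)
  finally have LX'_comm: "L ** X' = X' ** L"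
    by (simp add: LX')
  have "poch_nat D k ** X = poch_nat D k ** (L' ** X') ** X"
    by (simp add: LX')
  also have "\<dots> = poch_nat M k ** (L ** X') ** X"
    by (simp add: matrix_mul_assoc swap)
  also have "\<dots> = poch_nat M k ** X' ** (L ** X)"
    by (simp add: LX'_comm matrix_mul_assoc)
  also have "\<dots> = poch_nat M k ** X'"
    by (simp add: LX)
  finally have "poch_nat D k ** X = poch_nat M k ** X'" .
  moreover have "M + mat (of_int j) = D"
    by (simp add: D_def j vec_eq_iff mat_def)
  ultimately show ?thesis
    by (simp only: X_def X'_def)
qed

section \<open>The binomial series\<close>

text \<open>
  Consecutive terms satisfy \<open>\<parallel>T\<^sub>n\<^sub>+\<^sub>1\<parallel> \<le> \<bar>s\<bar> (K + n) / (n + 1) \<parallel>T\<^sub>n\<parallel>\<close>, where \<open>K\<close> bounds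
  right multiplication by \<open>M\<close>; the factor tends to \<open>\<bar>s\<bar> < 1\<close>.
\<close>
lemma binomial_series_abs_summable:
  fixes M :: "complex^'d^'d"
  assumes "norm s < 1"
  shows "summable (\<lambda>n. norm ((s ^ n / fact n) \<star> poch_nat M n))"
proof -
  obtain K where K: "\<And>X :: complex^'d^'d. norm (X ** M) \<le> norm X * K" and "K > 0"
    using bounded_linear.pos_bounded[OF bounded_linear_matrix_mult_left[of M]] by auto
  define c where "c = (1 + norm s) / 2"
  have c: "norm s < c" "c < 1"
    using assms by (auto simp: c_def)
  have "(\<lambda>n. norm s * ((K + real n) / real (Suc n))) \<longlonglongrightarrow> norm s * 1"
    by (intro tendsto_mult tendsto_const) real_asymp
  then have "\<forall>\<^sub>F n in sequentially. norm s * ((K + real n) / real (Suc n)) < c"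
    using c by (auto intro: order_tendstoD)
  then obtain N where N: "\<And>n. n \<ge> N \<Longrightarrow> norm s * ((K + real n) / real (Suc n)) < c"
    by (auto simp: eventually_sequentially)
  show ?thesis
  proof (rule summable_ratio_test[OF c(2), of N])
    fix n assume "n \<ge> N"
    let ?T = "(s ^ n / fact n) \<star> poch_nat M n"
    have "(s ^ Suc n / fact (Suc n)) \<star> poch_nat M (Suc n)
        = (s / of_nat (Suc n)) \<star> (?T ** M + of_nat n \<star> ?T)"
      by (simp add: vec_eq_iff matrix_add_ldistrib mat_mult_right cscale_mult_left
          field_simps del: of_nat_Suc)
    then have "norm ((s ^ Suc n / fact (Suc n)) \<star> poch_nat M (Suc n))
        = norm s / real (Suc n) * norm (?T ** M + of_nat n \<star> ?T)"
      by (simp add: norm_cscale norm_divide del: of_nat_Suc)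
    also have "\<dots> \<le> norm s / real (Suc n) * (norm ?T * K + real n * norm ?T)"
      using norm_triangle_ineq[of "?T ** M" "of_nat n \<star> ?T"] K[of ?T] norm_cscale[of "of_nat n" ?T]
      by (intro mult_left_mono) auto
    also have "\<dots> = norm s * ((K + real n) / real (Suc n)) * norm ?T"
      by (simp add: field_simps)
    also have "\<dots> \<le> c * norm ?T"
      using N[OF \<open>n \<ge> N\<close>] by (intro mult_right_mono) auto
    finally show "norm (norm ((s ^ Suc n / fact (Suc n)) \<star> poch_nat M (Suc n)))
        \<le> c * norm (norm ?T)"
      by simp
  qed
qed

lemma binomial_series_sums:
  fixes M :: "complex^'d^'d"
  assumes "norm s < 1"
  shows "(\<lambda>n. (s ^ n / fact n) \<star> poch_nat M n) sums one_minus_powr_neg s M"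
  unfolding one_minus_powr_neg_def poch_of_nat
  by (intro summable_sums summable_norm_cancel[OF binomial_series_abs_summable[OF assms]])

lemma binomial_series_bounded:
  fixes M :: "complex^'d^'d"
  assumes "r < 1"
  obtains K where "K > 0" "\<And>s. norm s \<le> r \<Longrightarrow> norm (one_minus_powr_neg s M) \<le> K"
proof -
  let ?f = "\<lambda>s n. (s ^ n / fact n) \<star> poch_nat M n"
  let ?K = "\<Sum>n. norm (?f (of_real r) n)"
  show thesis
  proof
    show "norm (one_minus_powr_neg s M) \<le> max 1 ?K" if "norm s \<le> r" for s
    proof -
      have "0 \<le> r"
        using norm_ge_zero[of s] that by linarith
      have sr: "norm s < 1" "norm (of_real r :: complex) < 1"
        using that \<open>r < 1\<close> \<open>0 \<le> r\<close> by auto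
      have "norm (one_minus_powr_neg s M) \<le> (\<Sum>n. norm (?f s n))"
        using summable_norm[OF binomial_series_abs_summable[OF sr(1)], of M]
        by (simp add: one_minus_powr_neg_def)
      also have "\<dots> \<le> (\<Sum>n. norm (?f (of_real r) n))"
        using that \<open>0 \<le> r\<close>
        by (intro suminf_le binomial_series_abs_summable sr)
          (auto simp: norm_cscale norm_divide norm_mult norm_power
            intro!: mult_right_mono divide_right_mono power_mono)
      finally show ?thesis by simp
    qed
  qed simp
qed

text \<open>
  Multiplication by \<open>1 - s\<close> subtracts \<open>(M)\<^sub>n / n!\<close> from \<open>(M)\<^sub>n\<^sub>+\<^sub>1 / (n+1)!\<close>, which leaves
  \<open>(M)\<^sub>n (M - I) / (n+1)! = (M - I)\<^sub>n\<^sub>+\<^sub>1 / (n+1)!\<close>.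
\<close>
lemma one_minus_powr_neg_diff_one:
  fixes M :: "complex^'d^'d"
  assumes "norm s < 1"
  shows "(1 - s) \<star> one_minus_powr_neg s M = one_minus_powr_neg s (M - mat 1)"
proof -
  let ?f = "\<lambda>n. (s ^ n / fact n) \<star> poch_nat M n"
  let ?g = "\<lambda>n. (s ^ n / fact n) \<star> poch_nat (M - mat 1) n"
  let ?S = "one_minus_powr_neg s M"
  have f: "?f sums ?S"
    by (rule binomial_series_sums) fact
  have step: "?g (Suc n) = ?f (Suc n) - s \<star> ?f n" for n
  proof -
    have "poch_nat (M - mat 1) (Suc n) = poch_nat M n ** (M + mat (- 1))"
    proof -
      have "M - mat 1 = M + mat (- 1)"
        by (simp add: vec_eq_iff mat_def)
      moreover have "poch_nat M n ** (M + mat (- 1)) = (M + mat (- 1)) ** poch_nat M n"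
        by (intro poch_nat_commute commute_shift[symmetric] refl)
      ultimately show ?thesis
        by (metis poch_nat_pred)
    qed
    also have "\<dots> = poch_nat M (Suc n) - of_nat (Suc n) \<star> poch_nat M n"
      by (simp add: matrix_add_ldistrib mat_mult_right vec_eq_iff algebra_simps)
    finally have "poch_nat (M - mat 1) (Suc n) $ i $ j
        = poch_nat M (Suc n) $ i $ j - of_nat (Suc n) * poch_nat M n $ i $ j" for i j
      by simp
    then show ?thesis
      by (simp add: vec_eq_iff right_diff_distrib del: of_nat_Suc poch_nat.simps)
  qed
  have "(\<lambda>n. ?f (Suc n)) sums (?S - ?f 0)"
    by (rule iffD2[OF sums_Suc_iff[of ?f]]) (use f in simp)
  moreover have "(\<lambda>n. s \<star> ?f n) sums (s \<star> ?S)"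
    by (rule bounded_linear.sums[OF bounded_linear_cscale f])
  ultimately have "(\<lambda>n. ?g (Suc n)) sums (?S - ?f 0 - s \<star> ?S)"
    unfolding step by (rule sums_diff)
  then have "?g sums (?S - ?f 0 - s \<star> ?S + ?g 0)"
    by (subst (asm) sums_Suc_iff)
  then have "?g sums ((1 - s) \<star> ?S)"
    by (rule back_subst[of "\<lambda>x. ?g sums x"]) (simp add: vec_eq_iff algebra_simps)
  then show ?thesis
    using binomial_series_sums[OF assms] sums_unique2 by blast
qed

lemma one_minus_powr_neg_diff_int:
  fixes M :: "complex^'d^'d"
  assumes "norm s < 1"
  shows "((1 - s) powi e) \<star> one_minus_powr_neg s M = one_minus_powr_neg s (M - mat (of_int e))"
proof -
  have s: "1 - s \<noteq> 0"
    using assms by auto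
  let ?S = "\<lambda>e. one_minus_powr_neg s (M - mat (of_int e))"
  have step: "(1 - s) \<star> ?S i = ?S (i + 1)" for i
  proof -
    have "M - mat (of_int i) - mat 1 = M - mat (of_int (i + 1))"
      by (simp add: vec_eq_iff mat_def)
    then show ?thesis
      by (simp only: one_minus_powr_neg_diff_one[OF assms])
  qed
  show ?thesis
  proof (induction e rule: int_induct[where k = 0])
    case base
    have "M - mat 0 = M"
      by (simp add: vec_eq_iff mat_def)
    then show ?case by simp
  next
    case (step1 i)
    have "((1 - s) powi (i + 1)) \<star> one_minus_powr_neg s M
        = (1 - s) \<star> ((1 - s) powi i) \<star> one_minus_powr_neg s M"
      using s by (simp add: cscale_cscale power_int_add mult.commute)
    then show ?case
      by (simp only: step1.IH step)
  next
    case (step2 i)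
    have "(1 - s) \<star> ?S (i - 1) = (1 - s) \<star> ((1 - s) powi (i - 1)) \<star> one_minus_powr_neg s M"
      using step2.IH step[of "i - 1"] s
      by (simp add: cscale_cscale power_int_diff)
    then show ?case
      using s by (simp add: vec_eq_iff)
  qed
qed

lemma binomial_series_entry_sums:
  fixes M W :: "complex^'d^'d"
  assumes "norm s < 1"
  shows "(\<lambda>n. ((1 / fact n) \<star> (poch_nat M n ** W)) $ p $ q * s ^ n)
           sums (one_minus_powr_neg s M ** W) $ p $ q"
proof -
  have "bounded_linear (\<lambda>X :: complex^'d^'d. (X ** W) $ p $ q)"
    by (rule bounded_linear_compose[OF bounded_linear_entry bounded_linear_matrix_mult_left])
  from bounded_linear.sums[OF this binomial_series_sums[OF assms, of M]] show ?thesis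
    by (simp add: cscale_mult_left mult.commute)
qed

text \<open>
  Holomorphy is a notion for complex-valued functions, so the analytic facts are stated for the
  entries of \<open>(1 - s)\<^sup>-\<^sup>M W\<close>.
\<close>
lemma binomial_series_entry_holomorphic:
  fixes M W :: "complex^'d^'d"
  shows "(\<lambda>s. (one_minus_powr_neg s M ** W) $ p $ q) holomorphic_on ball 0 1"
proof (rule power_series_holomorphic)
  fix s :: complex
  assume "s \<in> ball 0 1"
  then show "(\<lambda>n. ((1 / fact n) \<star> (poch_nat M n ** W)) $ p $ q * (s - 0) ^ n)
      sums (one_minus_powr_neg s M ** W) $ p $ q"
    using binomial_series_entry_sums[of s M W p q] by simp
qed

lemma binomial_series_entry_higher_deriv:
  fixes M W :: "complex^'d^'d"
  shows "(deriv ^^ k) (\<lambda>s. (one_minus_powr_neg s M ** W) $ p $ q) 0 = (poch_nat M k ** W) $ p $ q"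
proof -
  let ?a = "\<lambda>n. ((1 / fact n) \<star> (poch_nat M n ** W)) $ p $ q"
  let ?f = "\<lambda>s. (one_minus_powr_neg s M ** W) $ p $ q"
  have "fps_conv_radius (Abs_fps ?a) \<ge> 1"
    unfolding fps_conv_radius_def
  proof (rule conv_radius_geI_ex')
    fix r :: real
    assume "0 < r" "ereal r < 1"
    then have "norm (of_real r :: complex) < 1"
      by simp
    from binomial_series_entry_sums[OF this, of M W p q]
    show "summable (\<lambda>n. fps_nth (Abs_fps ?a) n * of_real r ^ n)"
      by (simp add: sums_iff)
  qed
  then have "fps_conv_radius (Abs_fps ?a) > 0"
    by (rule less_le_trans[rotated]) simp
  moreover have "\<forall>\<^sub>F s in nhds 0. eval_fps (Abs_fps ?a) s = ?f s"
    using eventually_nhds_in_open[of "ball 0 1" "0 :: complex"]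
  proof (rule eventually_mono)
    fix s :: complex assume "s \<in> ball 0 1"
    then show "eval_fps (Abs_fps ?a) s = ?f s"
      using binomial_series_entry_sums[of s M W p q] by (simp add: eval_fps_def sums_iff)
  qed auto
  ultimately have "?f has_fps_expansion Abs_fps ?a"
    by (simp add: has_fps_expansion_def)
  then have "fps_nth (Abs_fps ?a) k = (deriv ^^ k) ?f 0 / fact k"
    by (rule fps_nth_fps_expansion)
  then show ?thesis
    by simp
qed

section \<open>Abel's limit theorem and continuation to the boundary of a disc\<close>

text \<open>
  Summation by parts: \<open>(\<Sum>n. a\<^sub>n r\<^sup>n) = (1 - r) (\<Sum>n. S\<^sub>n r\<^sup>n)\<close> with partial sums \<open>S\<^sub>n \<longlonglongrightarrow> 0\<close>. The
  finitely many large \<open>S\<^sub>n\<close> are damped by the factor \<open>1 - r\<close>, the others contribute at most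
  \<open>\<epsilon> / 2\<close> because \<open>(1 - r) (\<Sum>n. r\<^sup>n) = 1\<close>.
\<close>
lemma Abel_limit_zero:
  fixes a :: "nat \<Rightarrow> complex"
  assumes sums: "a sums 0"
  shows "((\<lambda>r. \<Sum>n. a n * of_real r ^ n) \<longlongrightarrow> 0) (at_left 1)"
proof (rule tendstoI)
  fix \<epsilon> :: real assume "\<epsilon> > 0"
  define S where "S n = (\<Sum>k\<le>n. a k)" for n
  have "S \<longlonglongrightarrow> 0"
    using sums by (simp add: S_def[abs_def] sums_def_le)
  then obtain N where N: "\<And>n. n \<ge> N \<Longrightarrow> norm (S n) < \<epsilon> / 2"
    using \<open>\<epsilon> > 0\<close> by (metis LIMSEQ_D diff_zero half_gt_zero)
  define K where "K = (\<Sum>n<N. norm (S n))"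
  have bound: "norm (\<Sum>n. a n * of_real r ^ n) \<le> (1 - r) * K + \<epsilon> / 2"
    if r: "0 < r" "r < 1" for r :: real
  proof -
    let ?z = "of_real r :: complex"
    have z: "norm ?z < 1" using r by simp
    have S_le: "norm (S n * ?z ^ n) \<le> (if n < N then norm (S n) else 0) + \<epsilon> / 2 * r ^ n" for n
    proof (cases "n < N")
      case True
      have "norm (S n) * r ^ n \<le> norm (S n) * 1"
        using r by (intro mult_left_mono power_le_one) auto
      then show ?thesis
        using True r \<open>\<epsilon> > 0\<close> by (simp add: norm_mult norm_power add_increasing2)
    next
      case False
      then show ?thesis
        using r N[of n] by (simp add: norm_mult norm_power mult_right_mono less_imp_le)
    qed
    have fin: "(\<lambda>n. if n < N then norm (S n) else 0) sums K"
      using sums_finite[of "{..<N}" "\<lambda>n. if n < N then norm (S n) else 0"] by (simp add: K_def)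
    have geo: "(\<lambda>n. \<epsilon> / 2 * r ^ n) sums (\<epsilon> / 2 * (1 / (1 - r)))"
      using r by (intro sums_mult geometric_sums) auto
    note maj = sums_add[OF fin geo]
    have sS: "summable (\<lambda>n. norm (S n * ?z ^ n))"
      by (rule summable_comparison_test'[OF sums_summable[OF maj], of 0]) (use S_le in auto)
    have "norm (\<Sum>n. S n * ?z ^ n) \<le> (\<Sum>n. norm (S n * ?z ^ n))"
      by (rule summable_norm[OF sS])
    also have "\<dots> \<le> K + \<epsilon> / 2 * (1 / (1 - r))"
      using suminf_le[OF S_le sS sums_summable[OF maj]] sums_unique[OF maj] by simp
    finally have le: "norm (\<Sum>n. S n * ?z ^ n) \<le> K + \<epsilon> / 2 * (1 / (1 - r))" .
    let ?T = "\<Sum>n. S n * ?z ^ n"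
    have T: "(\<lambda>n. S n * ?z ^ n) sums ?T"
      using summable_norm_cancel[OF sS] by (rule summable_sums)
    have "(\<lambda>n. S (Suc n) * ?z ^ Suc n) sums (?T - S 0 * ?z ^ 0)"
      using T by (subst sums_Suc_iff) simp
    moreover have "(\<lambda>n. ?z * (S n * ?z ^ n)) sums (?z * ?T)"
      using T by (rule sums_mult)
    ultimately have "(\<lambda>n. S (Suc n) * ?z ^ Suc n - ?z * (S n * ?z ^ n)) sums (?T - S 0 * ?z ^ 0 - ?z * ?T)"
      by (rule sums_diff)
    also have "(\<lambda>n. S (Suc n) * ?z ^ Suc n - ?z * (S n * ?z ^ n)) = (\<lambda>n. a (Suc n) * ?z ^ Suc n)"
      by (auto simp: S_def algebra_simps)
    finally have "(\<lambda>n. a n * ?z ^ n) sums (?T - S 0 * ?z ^ 0 - ?z * ?T + a 0 * ?z ^ 0)"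
      by (subst (asm) sums_Suc_iff)
    then have sum_parts: "(\<Sum>n. a n * ?z ^ n) = (1 - ?z) * ?T"
      by (simp add: S_def sums_iff algebra_simps)
    have "norm (\<Sum>n. a n * ?z ^ n) = (1 - r) * norm ?T"
    proof -
      have "norm (1 - ?z) = \<bar>1 - r\<bar>"
        using norm_of_real[of "1 - r", where 'a = complex] by simp
      then show ?thesis
        using sum_parts r by (simp add: norm_mult)
    qed
    also have "\<dots> \<le> (1 - r) * (K + \<epsilon> / 2 * (1 / (1 - r)))"
      using r le by (intro mult_left_mono) auto
    also have "\<dots> = (1 - r) * K + \<epsilon> / 2"
      using r by (simp add: field_simps)
    finally show ?thesis .
  qed
  have "((\<lambda>r :: real. (1 - r) * K + \<epsilon> / 2) \<longlongrightarrow> (1 - 1) * K + \<epsilon> / 2) (at_left 1)"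
    by (intro tendsto_intros)
  then have "\<forall>\<^sub>F r in at_left 1. (1 - r) * K + \<epsilon> / 2 < \<epsilon>"
    by (rule order_tendstoD(2)) (use \<open>\<epsilon> > 0\<close> in simp)
  moreover have "\<forall>\<^sub>F r in at_left (1 :: real). 0 < r \<and> r < 1"
    using eventually_at_left_real[of 0 "1 :: real"] by simp
  ultimately show "\<forall>\<^sub>F r in at_left 1. dist (\<Sum>n. a n * of_real r ^ n) 0 < \<epsilon>"
    by eventually_elim (use bound in force)
qed

theorem Abel_limit:
  fixes a :: "nat \<Rightarrow> complex"
  assumes sums: "a sums L"
  shows "((\<lambda>r. \<Sum>n. a n * of_real r ^ n) \<longlongrightarrow> L) (at_left 1)"
proof -
  define b where "b n = a n - (if n = 0 then L else 0)" for n
  have "(\<lambda>n. if n = 0 then L else 0) sums L"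
    using sums_single[of 0 "\<lambda>_. L"] by simp
  from sums_diff[OF sums this] have b: "b sums 0"
    by (simp add: b_def[abs_def])
  have "((\<lambda>r. L + (\<Sum>n. b n * of_real r ^ n)) \<longlongrightarrow> L + 0) (at_left 1)"
    by (intro tendsto_intros Abel_limit_zero b)
  moreover have "\<forall>\<^sub>F r in at_left (1 :: real). L + (\<Sum>n. b n * of_real r ^ n) = (\<Sum>n. a n * of_real r ^ n)"
  proof -
    have "\<forall>\<^sub>F r in at_left (1 :: real). 0 < r \<and> r < 1"
      using eventually_at_left_real[of 0 "1 :: real"] by simp
    then show ?thesis
    proof eventually_elim
      case (elim r)
      have "summable (\<lambda>n. b n * of_real r ^ n)"
        by (rule powser_inside[of b 1]) (use b elim in \<open>auto simp: sums_iff\<close>)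
      moreover have "(\<lambda>n. if n = 0 then L else 0) sums L"
        using sums_single[of 0 "\<lambda>_. L"] by simp
      ultimately have "(\<lambda>n. (if n = 0 then L else 0) + b n * of_real r ^ n) sums (L + (\<Sum>n. b n * of_real r ^ n))"
        by (intro sums_add summable_sums)
      moreover have "(\<lambda>n. (if n = 0 then L else 0) + b n * of_real r ^ n) = (\<lambda>n. a n * of_real r ^ n)"
        by (auto simp: b_def)
      ultimately show ?case
        by (simp add: sums_iff)
    qed
  qed
  ultimately show ?thesis
    by (auto dest: Lim_transform_eventually)
qed

text \<open>
  A straight segment from \<open>0\<close> to \<open>t\<close> may come closer to \<open>1\<close> than both of its ends do. The path
  used instead prescribes the distances to \<open>0\<close> and \<open>1\<close>, both affine in the parameter, and takes the
  third vertex of the triangle with these side lengths, on the side of the real axis where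
  \<open>t\<close> lies.
\<close>
lemma path_between_moduli:
  fixes t :: complex
  obtains g where "continuous_on {0..1} g" "g 0 = 0" "g 1 = t"
    "\<And>l. l \<in> {0..1} \<Longrightarrow> norm (g l) = l * norm t"
    "\<And>l. l \<in> {0..1} \<Longrightarrow> norm (1 - g l) = 1 + l * (norm (1 - t) - 1)"
proof -
  define q where "q l = 1 + l * (norm (1 - t) - 1)" for l :: real
  define p where "p l = l * norm t" for l :: real
  \<comment> \<open>Law of cosines: a point at distance \<open>p\<close> from \<open>0\<close> and \<open>q\<close> from \<open>1\<close> has this real part.\<close>
  define u where "u l = (1 + (p l)\<^sup>2 - (q l)\<^sup>2) / 2" for l :: real
  define \<sigma> :: real where "\<sigma> = (if Im t \<ge> 0 then 1 else - 1)"
  define g where "g l = Complex (u l) (\<sigma> * sqrt ((p l)\<^sup>2 - (u l)\<^sup>2))" for l :: real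
  have sq: "\<sigma>\<^sup>2 = 1" by (simp add: \<sigma>_def)
  have tri1: "\<bar>norm (1 - t) - 1\<bar> \<le> norm t"
    using norm_triangle_ineq3[of "1 - t" 1] by simp
  have tri2: "norm t \<le> 1 + norm (1 - t)"
    using norm_triangle_ineq4[of 1 "1 - t"] by simp
  \<comment> \<open>A triangle with sides \<open>1\<close>, \<open>p l\<close>, \<open>q l\<close> exists, because the triangle inequalities are affine
    in \<open>l\<close> and hold for \<open>l = 0\<close> and \<open>l = 1\<close>.\<close>
  have nonneg: "(u l)\<^sup>2 \<le> (p l)\<^sup>2" if l: "l \<in> {0..1}" for l
  proof -
    have 1: "\<bar>q l - 1\<bar> \<le> p l"
      using l tri1 by (auto simp: q_def p_def abs_mult intro!: mult_left_mono)
    have "l * (1 + norm t - norm (1 - t)) \<ge> 0" "l * (1 + norm (1 - t) - norm t) \<ge> 0"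
      using l tri1 tri2 by auto
    then have 2: "p l \<le> 1 + q l"
      using l by (auto simp: q_def p_def algebra_simps)
    \<comment> \<open>Heron's formula: the product is \<open>16\<close> times the squared area, and the height is the
      imaginary part.\<close>
    have "0 \<le> ((p l)\<^sup>2 - (q l - 1)\<^sup>2) * ((1 + q l)\<^sup>2 - (p l)\<^sup>2)"
    proof (intro mult_nonneg_nonneg)
      show "0 \<le> (p l)\<^sup>2 - (q l - 1)\<^sup>2"
        using abs_le_square_iff[of "q l - 1" "p l"] 1 by auto
      have "0 \<le> p l" using l by (simp add: p_def)
      then show "0 \<le> (1 + q l)\<^sup>2 - (p l)\<^sup>2"
        using 2 by (simp add: power_mono)
    qed
    also have "\<dots> = 4 * ((p l)\<^sup>2 - (u l)\<^sup>2)"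
      unfolding u_def by (simp add: field_simps power2_eq_square)
    finally show ?thesis by simp
  qed
  have q_nonneg: "q l \<ge> 0" if l: "l \<in> {0..1}" for l
  proof -
    have "q l = (1 - l) * 1 + l * norm (1 - t)"
      by (simp add: q_def algebra_simps)
    also have "\<dots> \<ge> 0"
      using l by (intro add_nonneg_nonneg mult_nonneg_nonneg) auto
    finally show ?thesis .
  qed
  have Im_sq: "(\<sigma> * sqrt ((p l)\<^sup>2 - (u l)\<^sup>2))\<^sup>2 = (p l)\<^sup>2 - (u l)\<^sup>2" if "l \<in> {0..1}" for l
    using nonneg[OF that] by (simp add: power_mult_distrib sq)
  have ng: "norm (g l) = p l" if l: "l \<in> {0..1}" for l
  proof -
    have "norm (g l) = sqrt ((u l)\<^sup>2 + ((p l)\<^sup>2 - (u l)\<^sup>2))"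
      using Im_sq[OF l] by (simp add: g_def cmod_def)
    moreover have "p l \<ge> 0"
      using l by (simp add: p_def)
    ultimately show ?thesis
      by simp
  qed
  have n1g: "norm (1 - g l) = q l" if l: "l \<in> {0..1}" for l
  proof -
    have "norm (1 - g l) = sqrt ((1 - u l)\<^sup>2 + ((p l)\<^sup>2 - (u l)\<^sup>2))"
      using Im_sq[OF l] by (simp add: g_def cmod_def)
    also have "(1 - u l)\<^sup>2 + ((p l)\<^sup>2 - (u l)\<^sup>2) = (q l)\<^sup>2"
      unfolding u_def by (simp add: field_simps power2_eq_square)
    finally show ?thesis
      using q_nonneg[OF l] by simp
  qed
  have g0: "g 0 = 0"
    using ng[of 0] by (simp add: p_def)
  have u1: "u 1 = Re t"
  proof -
    have "(norm (1 - t))\<^sup>2 = (1 - Re t)\<^sup>2 + (Im t)\<^sup>2" "(norm t)\<^sup>2 = (Re t)\<^sup>2 + (Im t)\<^sup>2"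
      by (simp_all add: cmod_power2)
    then have "u 1 = (1 + ((Re t)\<^sup>2 + (Im t)\<^sup>2) - ((1 - Re t)\<^sup>2 + (Im t)\<^sup>2)) / 2"
      by (simp add: u_def p_def q_def)
    then show ?thesis
      by (simp add: power2_diff)
  qed
  have g1: "g 1 = t"
  proof -
    have "(p 1)\<^sup>2 - (u 1)\<^sup>2 = (Im t)\<^sup>2"
      by (simp add: u1 p_def cmod_power2)
    then show ?thesis
      by (simp add: g_def u1 complex_eq_iff \<sigma>_def)
  qed
  have "continuous_on {0..1} g"
    unfolding g_def Complex_eq u_def p_def q_def by (intro continuous_intros) auto
  then show thesis
    using that[OF _ g0 g1] ng n1g by (simp add: p_def q_def)
qed

definition disc_annulus :: "real \<Rightarrow> real \<Rightarrow> real \<Rightarrow> complex set" where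
  "disc_annulus R \<rho>\<^sub>1 \<rho>\<^sub>2 = {s. norm s < R \<and> \<rho>\<^sub>1 < norm (1 - s) \<and> norm (1 - s) < \<rho>\<^sub>2}"

lemma open_disc_annulus: "open (disc_annulus R \<rho>\<^sub>1 \<rho>\<^sub>2)"
  unfolding disc_annulus_def
  by (intro open_Collect_conj open_Collect_less continuous_intros)

text \<open>
  The set \<open>G\<close> where both \<open>F\<close> and its Taylor series are available may be a disc with bites taken out
  near \<open>1\<close> and \<open>-1\<close>. Its component \<open>C\<close> containing \<open>0\<close> contains the path of
  \<open>path_between_moduli\<close> without its end point \<open>t\<close>, and therefore also the part \<open>H\<close> of the disc near \<open>t\<close>. On \<open>C\<close> the
  identity theorem applies, and \<open>H\<close> contains the end of the radius to \<open>t\<close>, along which Abel's theorem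
  gives the limit of the series.
\<close>
lemma power_series_sum_at_boundary:
  assumes holo: "F holomorphic_on disc_annulus R \<rho>\<^sub>1 \<rho>\<^sub>2"
    and coeff: "\<And>k. c k = (deriv ^^ k) F 0 / fact k"
    and R: "norm t < R" and \<rho>: "\<rho>\<^sub>1 < 1" "1 < \<rho>\<^sub>2" "\<rho>\<^sub>1 < norm (1 - t)" "norm (1 - t) < \<rho>\<^sub>2"
    and summable: "summable (\<lambda>k. c k * t ^ k)"
  shows "(\<Sum>k. c k * t ^ k) = F t"
proof (cases "t = 0")
  case True
  then show ?thesis
    using coeff[of 0] by simp
next
  case False
  define Y where "Y = disc_annulus R \<rho>\<^sub>1 \<rho>\<^sub>2"
  define G where "G = Y \<inter> ball 0 (norm t)"
  define f where "f s = (\<Sum>k. c k * s ^ k)" for s :: complex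
  define C where "C = connected_component_set G 0"
  have "open Y"
    unfolding Y_def by (rule open_disc_annulus)
  have "t \<in> Y"
    using R \<rho> by (simp add: Y_def disc_annulus_def)
  then obtain \<epsilon> where \<epsilon>: "\<epsilon> > 0" "ball t \<epsilon> \<subseteq> Y"
    using \<open>open Y\<close> by (meson openE)
  have "open G"
    using \<open>open Y\<close> by (auto simp: G_def)
  have "0 \<in> G"
    using False \<rho> R norm_ge_zero[of t] by (auto simp: G_def Y_def disc_annulus_def simp del: norm_ge_zero)
  define H where "H = ball t \<epsilon> \<inter> ball 0 (norm t)"
  have "H \<subseteq> C"
  proof -
    obtain g where g: "continuous_on {0..1} g" "g 0 = 0" "g 1 = t"
      and ng: "\<And>l. l \<in> {0..1} \<Longrightarrow> norm (g l) = l * norm t"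
      and n1g: "\<And>l. l \<in> {0..1} \<Longrightarrow> norm (1 - g l) = 1 + l * (norm (1 - t) - 1)"
      using path_between_moduli[of t] by blast
    have gG: "g l \<in> G" if l: "0 \<le> l" "l < 1" for l
    proof -
      have lt: "l * norm t < norm t"
        using l False by simp
      have eq: "1 + l * (norm (1 - t) - 1) = (1 - l) * 1 + l * norm (1 - t)"
        by (simp add: algebra_simps)
      have "(1 - l) * \<rho>\<^sub>1 + l * \<rho>\<^sub>1 < (1 - l) * 1 + l * norm (1 - t)"
        using l \<rho> by (intro add_less_le_mono mult_strict_left_mono mult_left_mono) auto
      moreover have "(1 - l) * 1 + l * norm (1 - t) < (1 - l) * \<rho>\<^sub>2 + l * \<rho>\<^sub>2"
        using l \<rho> by (intro add_less_le_mono mult_strict_left_mono mult_left_mono) auto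
      ultimately show ?thesis
        using ng[of l] n1g[of l] l lt R by (simp add: G_def Y_def disc_annulus_def eq algebra_simps)
    qed
    obtain \<delta> where \<delta>: "\<delta> > 0" "\<And>l. l \<in> {0..1} \<Longrightarrow> dist l 1 < \<delta> \<Longrightarrow> dist (g l) t < \<epsilon>"
      using g(1) \<epsilon>(1) unfolding continuous_on_iff g(3)[symmetric]
      by (metis atLeastAtMost_iff le_numeral_extra(4) zero_le_one)
    define l where "l = max 0 (1 - \<delta> / 2)"
    have l: "0 \<le> l" "l < 1" "dist l 1 < \<delta>"
      using \<delta>(1) by (auto simp: l_def dist_real_def)
    have "g l \<in> H"
      using \<delta>(2)[of l] l ng[of l] False by (simp add: H_def dist_commute)
    moreover have "connected (g ` {0..<1})"
      by (intro connected_continuous_image continuous_on_subset[OF g(1)]) auto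
    moreover have "connected H"
      unfolding H_def by (intro convex_connected convex_Int convex_ball)
    moreover have "g l \<in> g ` {0..<1}"
      using l by simp
    ultimately have "connected (g ` {0..<1} \<union> H)"
      by (intro connected_Un) auto
    moreover have "0 \<in> g ` {0..<1} \<union> H"
      using g(2) by (metis UnI1 atLeastLessThan_iff imageI le_numeral_extra(3) zero_less_one)
    moreover have "g ` {0..<1} \<union> H \<subseteq> G"
      using gG \<epsilon>(2) by (auto simp: H_def G_def)
    ultimately have "g ` {0..<1} \<union> H \<subseteq> C"
      unfolding C_def by (intro connected_component_maximal)
    then show ?thesis by blast
  qed
  have "C \<subseteq> G"
    unfolding C_def by (rule connected_component_subset)
  have f_holo: "f holomorphic_on ball 0 (norm t)"
  proof (rule power_series_holomorphic)
    fix s :: complex assume "s \<in> ball 0 (norm t)"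
    then have "summable (\<lambda>k. c k * s ^ k)"
      using summable by (intro powser_inside[of c t s]) auto
    then show "(\<lambda>k. c k * (s - 0) ^ k) sums f s"
      by (simp add: f_def summable_sums)
  qed
  \<comment> \<open>The Taylor series represents \<open>F\<close> in a small disc; this starts the continuation.\<close>
  obtain r where r: "r > 0" "ball 0 r \<subseteq> G"
    using \<open>open G\<close> \<open>0 \<in> G\<close> by (meson openE)
  have near: "F s - f s = 0" if "s \<in> ball 0 r" for s
  proof -
    have "F holomorphic_on ball 0 r"
      using holo r(2) by (auto simp: G_def Y_def intro: holomorphic_on_subset)
    from holomorphic_power_series[OF this that] show ?thesis
      by (simp add: f_def coeff sums_iff)
  qed
  have eq: "F s = f s" if "s \<in> C" for s
  proof -
    have "F s - f s = 0"
    proof (rule analytic_continuation[where f = "\<lambda>s. F s - f s" and S = C and U = "ball 0 r" and \<xi> = 0])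
      show "(\<lambda>s. F s - f s) holomorphic_on C"
        using holo f_holo \<open>C \<subseteq> G\<close>
        by (auto simp: G_def Y_def intro!: holomorphic_on_diff intro: holomorphic_on_subset)
      show "open C"
        unfolding C_def using \<open>open G\<close> by (rule open_connected_component)
      show "ball 0 r \<subseteq> C"
        unfolding C_def using r by (intro connected_component_maximal) auto
      then show "0 \<in> C"
        using r by auto
      show "(0 :: complex) islimpt ball 0 r"
        using r by (simp add: islimpt_ball)
    qed (use that near in \<open>auto simp: C_def\<close>)
    then show ?thesis by simp
  qed
  have lim_t: "((\<lambda>x. of_real x * t) \<longlongrightarrow> t) (at_left (1 :: real))"
    by (rule tendsto_eq_intros refl | simp)+
  have "isCont F t"
    using holo \<open>open Y\<close> \<open>t \<in> Y\<close> unfolding Y_def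
    by (metis continuous_on_eq_continuous_at holomorphic_on_imp_continuous_on)
  then have lim_F: "((\<lambda>x. F (of_real x * t)) \<longlongrightarrow> F t) (at_left (1 :: real))"
    using lim_t by (rule isCont_tendsto_compose)
  have lim_f: "((\<lambda>x. \<Sum>k. c k * t ^ k * of_real x ^ k) \<longlongrightarrow> (\<Sum>k. c k * t ^ k)) (at_left (1 :: real))"
    using summable by (intro Abel_limit summable_sums)
  have "\<forall>\<^sub>F x in at_left (1 :: real). 0 < x \<and> x < 1"
    using eventually_at_left_real[of 0 "1 :: real"] by simp
  moreover have "\<forall>\<^sub>F x in at_left (1 :: real). dist (of_real x * t) t < \<epsilon>"
    using lim_t \<epsilon>(1) by (rule tendstoD)
  ultimately have "\<forall>\<^sub>F x in at_left (1 :: real). (\<Sum>k. c k * t ^ k * of_real x ^ k) = F (of_real x * t)"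
  proof eventually_elim
    case (elim x)
    then have "of_real x * t \<in> H"
      using False by (auto simp: H_def dist_commute norm_mult)
    then have "F (of_real x * t) = f (of_real x * t)"
      using eq \<open>H \<subseteq> C\<close> by blast
    then show ?case
      by (simp add: f_def power_mult_distrib mult_ac)
  qed
  from Lim_transform_eventually[OF lim_f this] show ?thesis
    using lim_F tendsto_unique[of "at_left (1 :: real)"] by fastforce
qed

lemma power_series_sums_inside:
  assumes holo: "F holomorphic_on disc_annulus R \<rho>\<^sub>1 \<rho>\<^sub>2"
    and coeff: "\<And>k. c k = (deriv ^^ k) F 0 / fact k"
    and R: "norm t < R" and \<rho>: "\<rho>\<^sub>1 < 1 - norm t" "1 + norm t < \<rho>\<^sub>2"
  shows "(\<lambda>k. c k * t ^ k) sums F t"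
proof -
  define r where "r = min R (min (1 - \<rho>\<^sub>1) (\<rho>\<^sub>2 - 1))"
  have "ball 0 r \<subseteq> disc_annulus R \<rho>\<^sub>1 \<rho>\<^sub>2"
  proof
    fix s :: complex assume "s \<in> ball 0 r"
    then have "norm s < R" "norm s < 1 - \<rho>\<^sub>1" "norm s < \<rho>\<^sub>2 - 1"
      by (auto simp: r_def)
    then show "s \<in> disc_annulus R \<rho>\<^sub>1 \<rho>\<^sub>2"
      using norm_triangle_ineq2[of 1 s] norm_triangle_ineq4[of 1 s]
      by (simp add: disc_annulus_def)
  qed
  with holo have "F holomorphic_on ball 0 r"
    by (rule holomorphic_on_subset)
  moreover have "t \<in> ball 0 r"
    using R \<rho> by (simp add: r_def)
  ultimately show ?thesis
    using holomorphic_power_series[of F 0 r t] by (simp add: coeff)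
qed

section \<open>Resummation of binomial series\<close>

lemma matrix_sums_entrywise:
  fixes X :: "nat \<Rightarrow> complex^'d^'d"
  assumes "\<And>p q. (\<lambda>k. X k $ p $ q) sums (L $ p $ q)"
  shows "X sums L"
  using assms unfolding sums_def by (intro vec_tendstoI) simp

lemma higher_deriv_sum:
  fixes f :: "'i \<Rightarrow> complex \<Rightarrow> complex"
  assumes "finite I" "\<And>i. i \<in> I \<Longrightarrow> f i holomorphic_on S" "open S" "z \<in> S"
  shows "(deriv ^^ k) (\<lambda>s. \<Sum>i\<in>I. f i s) z = (\<Sum>i\<in>I. (deriv ^^ k) (f i) z)"
  using assms
proof (induction I rule: finite_induct)
  case empty
  then show ?case by simp
next
  case (insert i I)
  then have "(deriv ^^ k) (\<lambda>s. f i s + (\<Sum>i\<in>I. f i s)) z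
      = (deriv ^^ k) (f i) z + (deriv ^^ k) (\<lambda>s. \<Sum>i\<in>I. f i s) z"
    by (intro higher_deriv_add[of _ S]) (auto intro!: holomorphic_on_sum)
  then show ?case
    using insert by simp
qed

text \<open>
  By this bound, absolute convergence of a Laurent series on two circles gives uniform convergence
  on the annulus between them.
\<close>
lemma power_int_between:
  fixes a v b :: real
  assumes "0 < a" "a \<le> v" "v \<le> b"
  shows "v powi e \<le> a powi e + b powi e"
proof (cases "e \<ge> 0")
  case True
  then have "v powi e \<le> b powi e"
    using assms by (intro power_int_mono) auto
  then show ?thesis
    using assms by (simp add: add_increasing)
next
  case False
  then have "v powi e \<le> a powi e"
    using assms by (intro power_int_antimono) auto
  then show ?thesis
    using assms by (simp add: add_increasing2)
qed

text \<open>
  The family \<open>(1 - s)\<^sup>-\<^sup>P (1 - s)\<^sup>e\<^sup>(\<^sup>i\<^sup>) W\<^sub>i\<close> is dominated by a summable family \<open>M\<close> on the part of the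
  annulus inside a disc of radius less than \<open>1\<close>. By the Weierstrass test and Weierstrass' theorem its sum
  \<open>F\<close> is holomorphic there and has Taylor coefficients that can be computed term by term; no
  rearrangement of a triple series is needed. The two conclusions are then the two
  representation results for Taylor series above, applied to each entry.
\<close>
proposition binomial_resummation:
  fixes P :: "complex^'d^'d" and W c :: "_ \<Rightarrow> complex^'d^'d" and e :: "'i \<Rightarrow> int"
  assumes t: "norm t < 1"
    and \<rho>: "0 < \<rho>\<^sub>1" "\<rho>\<^sub>1 < 1" "1 < \<rho>\<^sub>2" "\<rho>\<^sub>1 < norm (1 - t)" "norm (1 - t) < \<rho>\<^sub>2"
    and sm1: "(\<lambda>i. norm (W i) * \<rho>\<^sub>1 powi e i) summable_on UNIV"
    and sm2: "(\<lambda>i. norm (W i) * \<rho>\<^sub>2 powi e i) summable_on UNIV"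
    and coeff: "\<And>k. ((\<lambda>i. poch_nat (P - mat (of_int (e i))) k ** W i) has_sum c k) UNIV"
  defines "lhs \<equiv> one_minus_powr_neg t P ** (\<Sum>\<^sub>\<infinity>i. ((1 - t) powi e i) \<star> W i)"
    and "rhs \<equiv> \<lambda>k. (t ^ k / fact k) \<star> c k"
  shows "\<rho>\<^sub>1 < 1 - norm t \<Longrightarrow> 1 + norm t < \<rho>\<^sub>2 \<Longrightarrow> rhs sums lhs"
    and "summable rhs \<Longrightarrow> (\<Sum>k. rhs k) = lhs"
proof -
  define R where "R = (1 + norm t) / 2"
  have R: "norm t < R" "R < 1" "0 < R"
    using t by (auto simp: R_def add_pos_nonneg)
  define Y where "Y = disc_annulus R \<rho>\<^sub>1 \<rho>\<^sub>2"
  have Y: "open Y" "0 \<in> Y" "t \<in> Y" "Y \<subseteq> ball 0 1"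
    using R \<rho> t open_disc_annulus by (auto simp: Y_def disc_annulus_def)
  define f where "f p q i s = (one_minus_powr_neg s (P - mat (of_int (e i))) ** W i) $ p $ q"
    for p q i s
  define F where "F p q s = (\<Sum>\<^sub>\<infinity>i. f p q i s)" for p q s
  obtain K where K: "\<And>(X :: complex^'d^'d) (Z :: complex^'d^'d). norm (X ** Z) \<le> norm X * norm Z * K" and "K > 0"
    using bounded_bilinear.pos_bounded[OF bounded_bilinear_matrix_mult] by metis
  obtain B where B: "B > 0" "\<And>s. norm s \<le> R \<Longrightarrow> norm (one_minus_powr_neg s P) \<le> B"
    using binomial_series_bounded[OF R(2)] by blast
  have product: "one_minus_powr_neg s (P - mat (of_int (e i))) ** W i
      = one_minus_powr_neg s P ** (((1 - s) powi e i) \<star> W i)" if "norm s < 1" for s i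
    by (simp add: cscale_mult_left cscale_mult_right flip: one_minus_powr_neg_diff_int[OF that])
  have powi_le: "norm ((1 - s) powi e i) \<le> \<rho>\<^sub>1 powi e i + \<rho>\<^sub>2 powi e i" if "s \<in> Y" for s i
    using that \<rho>(1) by (auto simp: Y_def disc_annulus_def norm_power_int intro!: power_int_between)
  define M where "M i = (norm (W i) * \<rho>\<^sub>1 powi e i + norm (W i) * \<rho>\<^sub>2 powi e i) * (B * K)" for i
  have M: "M summable_on UNIV"
    unfolding M_def by (intro summable_on_cmult_left summable_on_add sm1 sm2)
  have bound: "norm (f p q i s) \<le> M i" if "s \<in> Y" for p q i s
  proof -
    have s: "norm s < 1" "norm s \<le> R"
      using that R by (auto simp: Y_def disc_annulus_def)
    have "norm (f p q i s) \<le> norm (one_minus_powr_neg s P ** (((1 - s) powi e i) \<star> W i))"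
      unfolding f_def product[OF s(1)]
      by (rule order_trans[OF Finite_Cartesian_Product.norm_nth_le Finite_Cartesian_Product.norm_nth_le])
    also have "\<dots> \<le> norm (one_minus_powr_neg s P) * norm (((1 - s) powi e i) \<star> W i) * K"
      by (rule K)
    also have "\<dots> \<le> B * ((\<rho>\<^sub>1 powi e i + \<rho>\<^sub>2 powi e i) * norm (W i)) * K"
      unfolding norm_cscale using B s(2) powi_le[OF that] \<open>K > 0\<close>
      by (intro mult_right_mono mult_mono) (auto intro: order_trans[OF norm_ge_zero])
    finally show ?thesis
      by (simp add: M_def algebra_simps)
  qed
  have unif: "uniform_limit Y (\<lambda>I s. \<Sum>i\<in>I. f p q i s) (F p q) (finite_subsets_at_top UNIV)" for p q
    unfolding F_def using bound M by (rule Weierstrass_m_test_general)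
  have f_holo: "f p q i holomorphic_on Y" for p q i
    unfolding f_def using binomial_series_entry_holomorphic Y(4) by (rule holomorphic_on_subset)
  have F_holo: "F p q holomorphic_on Y" for p q
  proof (rule holomorphic_onI)
    fix z assume "z \<in> Y"
    then obtain r where r: "r > 0" "cball z r \<subseteq> Y"
      using Y(1) open_contains_cball by blast
    have "continuous_on (cball z r) (\<lambda>s. \<Sum>i\<in>I. f p q i s) \<and> (\<lambda>s. \<Sum>i\<in>I. f p q i s) holomorphic_on ball z r" for I
    proof -
      have "(\<lambda>s. \<Sum>i\<in>I. f p q i s) holomorphic_on cball z r"
        using f_holo r(2) by (intro holomorphic_on_sum) (auto intro: holomorphic_on_subset)
      then show ?thesis
        by (auto intro: holomorphic_on_imp_continuous_on holomorphic_on_subset)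
    qed
    then obtain "F p q holomorphic_on ball z r"
      using holomorphic_uniform_limit[OF always_eventually uniform_limit_on_subset[OF unif r(2)]
          finite_subsets_at_top_neq_bot] by blast
    then show "F p q field_differentiable at z within Y"
      using r(1) by (meson centre_in_ball field_differentiable_at_within holomorphic_on_imp_differentiable_at open_ball)
  qed
  have deriv_F: "(deriv ^^ k) (F p q) 0 = c k $ p $ q" for p q k
  proof -
    have "((\<lambda>I. (deriv ^^ k) (\<lambda>s. \<Sum>i\<in>I. f p q i s) 0) \<longlongrightarrow> (deriv ^^ k) (F p q) 0)
        (finite_subsets_at_top UNIV)"
      by (rule higher_deriv_complex_uniform_limit[OF unif _ _ Y(1,2)])
        (auto intro!: always_eventually holomorphic_on_sum f_holo)
    moreover have "(deriv ^^ k) (\<lambda>s. \<Sum>i\<in>I. f p q i s) 0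
        = (\<Sum>i\<in>I. (poch_nat (P - mat (of_int (e i))) k ** W i) $ p $ q)" if "finite I" for I
    proof -
      have "(deriv ^^ k) (f p q i) 0 = (poch_nat (P - mat (of_int (e i))) k ** W i) $ p $ q" for i
        unfolding f_def by (rule binomial_series_entry_higher_deriv)
      then show ?thesis
        by (simp add: higher_deriv_sum[where f = "f p q", OF that f_holo Y(1,2)])
    qed
    then have "\<forall>\<^sub>F I in finite_subsets_at_top UNIV. (deriv ^^ k) (\<lambda>s. \<Sum>i\<in>I. f p q i s) 0
        = (\<Sum>i\<in>I. (poch_nat (P - mat (of_int (e i))) k ** W i) $ p $ q)"
      by (intro eventually_finite_subsets_at_top_weakI) auto
    ultimately have "((\<lambda>I. \<Sum>i\<in>I. (poch_nat (P - mat (of_int (e i))) k ** W i) $ p $ q)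
        \<longlongrightarrow> (deriv ^^ k) (F p q) 0) (finite_subsets_at_top UNIV)"
      by (rule Lim_transform_eventually)
    moreover have "((\<lambda>I. \<Sum>i\<in>I. (poch_nat (P - mat (of_int (e i))) k ** W i) $ p $ q)
        \<longlongrightarrow> c k $ p $ q) (finite_subsets_at_top UNIV)"
      using has_sum_bounded_linear[OF bounded_linear_entry coeff] by (simp add: has_sum_def)
    ultimately show ?thesis
      by (intro tendsto_unique[OF finite_subsets_at_top_neq_bot])
  qed
  have F_t: "F p q t = lhs $ p $ q" for p q
  proof -
    have "(\<lambda>i. norm (((1 - t) powi e i) \<star> W i)) summable_on UNIV"
    proof (rule summable_on_comparison_test[OF summable_on_add[OF sm1 sm2]])
      fix i
      show "norm (((1 - t) powi e i) \<star> W i) \<le> norm (W i) * \<rho>\<^sub>1 powi e i + norm (W i) * \<rho>\<^sub>2 powi e i"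
        using mult_right_mono[OF powi_le[OF Y(3), of i], of "norm (W i)"]
        by (simp add: norm_cscale algebra_simps)
    qed auto
    then have "((\<lambda>i. ((1 - t) powi e i) \<star> W i) has_sum (\<Sum>\<^sub>\<infinity>i. ((1 - t) powi e i) \<star> W i)) UNIV"
      by (rule has_sum_infsum[OF abs_summable_summable])
    from has_sum_bounded_linear[OF bounded_linear_compose[OF bounded_linear_entry
          bounded_linear_matrix_mult_right] this]
    show ?thesis
      unfolding F_def f_def product[OF t] lhs_def by (rule infsumI)
  qed
  have entry: "rhs k $ p $ q = c k $ p $ q / fact k * t ^ k" for k p q
    by (simp add: rhs_def)
  have coeffs: "c k $ p $ q / fact k = (deriv ^^ k) (F p q) 0 / fact k" for k p q
    by (simp add: deriv_F)
  show "rhs sums lhs" if "\<rho>\<^sub>1 < 1 - norm t" "1 + norm t < \<rho>\<^sub>2"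
  proof (rule matrix_sums_entrywise)
    fix p q
    show "(\<lambda>k. rhs k $ p $ q) sums (lhs $ p $ q)"
      using power_series_sums_inside[OF F_holo[unfolded Y_def] coeffs R(1) that]
      by (simp add: entry F_t)
  qed
  show "(\<Sum>k. rhs k) = lhs" if "summable rhs"
  proof -
    have "(\<Sum>k. rhs k) $ p $ q = lhs $ p $ q" for p q
    proof -
      have sums: "(\<lambda>k. rhs k $ p $ q) sums ((\<Sum>k. rhs k) $ p $ q)"
        using bounded_linear.sums[OF bounded_linear_entry summable_sums[OF that]] .
      then have "summable (\<lambda>k. c k $ p $ q / fact k * t ^ k)"
        unfolding entry by (rule sums_summable)
      from power_series_sum_at_boundary[OF F_holo[unfolded Y_def] coeffs R(1) \<rho>(2-5) this]
      show ?thesis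
        using sums by (simp add: entry F_t sums_iff)
    qed
    then show ?thesis
      by (simp add: vec_eq_iff)
  qed
qed

section \<open>Radii of convergence along monomial curves\<close>

text \<open>
  Integer exponents \<open>a\<close>, \<open>b\<close> allow both substitutions, \<open>(x / v\<^sup>2, y / v)\<close> and \<open>(x v, y / v)\<close>, to
  be treated at once.
\<close>
lemma horn_H5_term_monomial_curve:
  assumes "v \<noteq> 0"
  shows "horn_H5_term A B C (x * v powi a) (y * v powi b) m n
           = (v powi (a * int m + b * int n)) \<star> horn_H5_term A B C x y m n"
proof -
  have "v powi (a * int m + b * int n) = (v powi a) ^ m * (v powi b) ^ n"
    using assms by (simp add: power_int_add power_int_mult)
  then show ?thesis
    by (simp add: horn_H5_term_def cscale_cscale power_mult_distrib mult_ac)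
qed

lemma H5_domain_abs_summable:
  assumes "(x, y) \<in> H5_domain A B C"
  shows "(\<lambda>(m, n). norm (horn_H5_term A B C x y m n)) summable_on UNIV"
  using assms interior_subset unfolding H5_domain_def by blast

lemma H5_domain_has_sum:
  assumes "(x, y) \<in> H5_domain A B C"
  shows "((\<lambda>(m, n). horn_H5_term A B C x y m n) has_sum horn_H5 A B C x y) UNIV"
proof -
  have "(\<lambda>i. norm (case i of (m, n) \<Rightarrow> horn_H5_term A B C x y m n)) summable_on UNIV"
    using H5_domain_abs_summable[OF assms] by (simp add: case_prod_unfold)
  then show ?thesis
    unfolding horn_H5_def by (rule has_sum_infsum[OF abs_summable_summable])
qed

text \<open>
  Absolute convergence of \<open>H\<^sub>5\<close> at \<open>(x v\<^sup>a, y v\<^sup>b)\<close> depends only on \<open>\<rho> = \<bar>v\<bar>\<close>, by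
  \<open>horn_H5_term_monomial_curve\<close>.
\<close>
definition curve_radius ::
  "complex^'d^'d \<Rightarrow> complex^'d^'d \<Rightarrow> complex^'d^'d \<Rightarrow> complex \<Rightarrow> complex \<Rightarrow> int \<Rightarrow> int \<Rightarrow> real \<Rightarrow> bool" where
  "curve_radius A B C x y a b \<rho> \<longleftrightarrow> \<rho> > 0 \<and>
     (\<lambda>(m, n). norm (horn_H5_term A B C x y m n) * \<rho> powi (a * int m + b * int n)) summable_on UNIV"

text \<open>
  The points \<open>v\<close> that the curve maps into the domain form an open set, since the domain is an
  interior. So \<open>(1 - h) v\<close> and \<open>(1 + h) v\<close> belong to it for small \<open>h\<close>.
\<close>
lemma curve_radius_around:
  assumes dom: "(x * v powi a, y * v powi b) \<in> H5_domain A B C" and "v \<noteq> 0"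
  obtains \<rho>\<^sub>1 \<rho>\<^sub>2 where "curve_radius A B C x y a b \<rho>\<^sub>1" "curve_radius A B C x y a b \<rho>\<^sub>2"
    "\<rho>\<^sub>1 < norm v" "norm v < \<rho>\<^sub>2"
proof -
  let ?D = "H5_domain A B C"
  let ?\<gamma> = "\<lambda>r :: real. (x * (of_real r * v) powi a, y * (of_real r * v) powi b)"
  have "(?\<gamma> \<longlongrightarrow> ?\<gamma> 1) (nhds 1)"
    by (intro tendsto_intros) (use \<open>v \<noteq> 0\<close> in \<open>auto intro: filterlim_ident\<close>)
  moreover have "open ?D"
    by (simp add: H5_domain_def)
  ultimately have "\<forall>\<^sub>F r in nhds 1. ?\<gamma> r \<in> ?D"
    using dom by (intro topological_tendstoD) auto
  then obtain \<delta> where \<delta>: "\<delta> > 0" "\<And>r. dist r 1 < \<delta> \<Longrightarrow> ?\<gamma> r \<in> ?D"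
    unfolding eventually_nhds_metric by blast
  have radius: "curve_radius A B C x y a b (r * norm v)" if r: "r > 0" "dist r 1 < \<delta>" for r
  proof -
    have "norm (horn_H5_term A B C (x * (of_real r * v) powi a) (y * (of_real r * v) powi b) m n)
        = norm (horn_H5_term A B C x y m n) * (r * norm v) powi (a * int m + b * int n)" for m n
      using r \<open>v \<noteq> 0\<close>
      by (subst horn_H5_term_monomial_curve) (auto simp: norm_cscale norm_power_int norm_mult)
    then show ?thesis
      using H5_domain_abs_summable[OF \<delta>(2)[OF r(2)]] r \<open>v \<noteq> 0\<close> by (simp add: curve_radius_def)
  qed
  define h where "h = min \<delta> 1 / 2"
  have h: "h > 0" "h < 1" "h < \<delta>"
    using \<delta>(1) by (auto simp: h_def)
  show thesis
  proof
    show "curve_radius A B C x y a b ((1 - h) * norm v)" "curve_radius A B C x y a b ((1 + h) * norm v)"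
      using h by (auto intro!: radius simp: dist_real_def)
    show "(1 - h) * norm v < norm v" "norm v < (1 + h) * norm v"
      using h \<open>v \<noteq> 0\<close> by (auto simp: algebra_simps)
  qed
qed

lemma curve_radius_around_finite:
  assumes "finite V" "V \<noteq> {}"
    and "\<And>v. v \<in> V \<Longrightarrow> v \<noteq> 0 \<and> (x * v powi a, y * v powi b) \<in> H5_domain A B C"
  shows "\<exists>\<rho>\<^sub>1 \<rho>\<^sub>2. curve_radius A B C x y a b \<rho>\<^sub>1 \<and> curve_radius A B C x y a b \<rho>\<^sub>2 \<and>
           (\<forall>v\<in>V. \<rho>\<^sub>1 < norm v \<and> norm v < \<rho>\<^sub>2)"
  using assms
proof (induction V rule: finite_ne_induct)
  case (singleton v)
  then show ?case
    using curve_radius_around[of x v a y b A B C] by (metis singletonD singletonI)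
next
  case (insert v V)
  obtain \<rho>\<^sub>1 \<rho>\<^sub>2 where old: "curve_radius A B C x y a b \<rho>\<^sub>1" "curve_radius A B C x y a b \<rho>\<^sub>2"
    "\<forall>v\<in>V. \<rho>\<^sub>1 < norm v \<and> norm v < \<rho>\<^sub>2"
    using insert by (metis insertI2)
  obtain \<sigma>\<^sub>1 \<sigma>\<^sub>2 where new: "curve_radius A B C x y a b \<sigma>\<^sub>1" "curve_radius A B C x y a b \<sigma>\<^sub>2"
    "\<sigma>\<^sub>1 < norm v" "norm v < \<sigma>\<^sub>2"
    using curve_radius_around[of x v a y b A B C] insert.prems by (metis insertI1)
  have "curve_radius A B C x y a b (min \<rho>\<^sub>1 \<sigma>\<^sub>1)" "curve_radius A B C x y a b (max \<rho>\<^sub>2 \<sigma>\<^sub>2)"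
    using old new by (auto simp: min_def max_def)
  then show ?case
    using old(3) new(3,4) by (intro exI[of _ "min \<rho>\<^sub>1 \<sigma>\<^sub>1"] exI[of _ "max \<rho>\<^sub>2 \<sigma>\<^sub>2"]) auto
qed

section \<open>The two summation formulae\<close>

text \<open>
  The common form of the two formulae. The sequences \<open>A'\<close> and \<open>B'\<close> hold the shifted and the
  unshifted parameter, and \<open>P\<close> is the one being shifted; the hypothesis \<open>shift\<close> says that the Taylor coefficients of the left-hand side are, term by
  term, those of the right-hand side.
\<close>
proposition horn_H5_resummation:
  fixes A B C P :: "complex^'d^'d" and A' B' :: "nat \<Rightarrow> complex^'d^'d"
  assumes t: "norm t < 1"
    and dom_1: "(x, y) \<in> H5_domain A B C"
    and dom_t: "(x * (1 - t) powi a, y * (1 - t) powi b) \<in> H5_domain A B C"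
    and dom_k: "\<And>k. (x, y) \<in> H5_domain (A' k) (B' k) C"
    and shift: "\<And>k m n. poch_nat (P - mat (of_int (a * int m + b * int n))) k ** horn_H5_term A B C x y m n
                  = poch_nat P k ** horn_H5_term (A' k) (B' k) C x y m n"
  defines "lhs \<equiv> one_minus_powr_neg t P ** horn_H5 A B C (x * (1 - t) powi a) (y * (1 - t) powi b)"
    and "rhs \<equiv> \<lambda>k. (t ^ k / fact k) \<star> (poch_nat P k ** horn_H5 (A' k) (B' k) C x y)"
  shows "(\<And>s. norm s \<le> norm t \<Longrightarrow> (x * (1 - s) powi a, y * (1 - s) powi b) \<in> H5_domain A B C)
           \<Longrightarrow> rhs sums lhs"
    and "summable rhs \<Longrightarrow> lhs = (\<Sum>k. rhs k)"
proof -
  define W where "W = (\<lambda>(m, n). horn_H5_term A B C x y m n)"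
  define e where "e = (\<lambda>(m, n). a * int m + b * int n)"
  have one_minus_t: "1 - t \<noteq> 0"
    using t by auto
  have coeff: "((\<lambda>i. poch_nat (P - mat (of_int (e i))) k ** W i) has_sum
      poch_nat P k ** horn_H5 (A' k) (B' k) C x y) UNIV" for k
  proof -
    have "poch_nat (P - mat (of_int (e i))) k ** W i
        = poch_nat P k ** (case i of (m, n) \<Rightarrow> horn_H5_term (A' k) (B' k) C x y m n)" for i
      by (cases i) (simp only: e_def W_def case_prod_conv shift)
    then show ?thesis
      using has_sum_bounded_linear[OF bounded_linear_matrix_mult_right H5_domain_has_sum[OF dom_k]]
      by simp
  qed
  have lhs: "lhs = one_minus_powr_neg t P ** (\<Sum>\<^sub>\<infinity>i. ((1 - t) powi e i) \<star> W i)"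
    unfolding lhs_def horn_H5_def W_def e_def
    by (simp add: horn_H5_term_monomial_curve[OF one_minus_t] case_prod_unfold)
  have radius: "\<rho> > 0" "(\<lambda>i. norm (W i) * \<rho> powi e i) summable_on UNIV"
    if "curve_radius A B C x y a b \<rho>" for \<rho>
    using that by (simp_all add: curve_radius_def W_def e_def case_prod_unfold)
  show "rhs sums lhs"
    if dom: "\<And>s. norm s \<le> norm t \<Longrightarrow> (x * (1 - s) powi a, y * (1 - s) powi b) \<in> H5_domain A B C"
  proof -
    \<comment> \<open>The points \<open>1 - \<bar>t\<bar>\<close> and \<open>1 + \<bar>t\<bar>\<close> have the extreme moduli among all \<open>1 - s\<close> with
      \<open>\<bar>s\<bar> \<le> \<bar>t\<bar>\<close>; radii that enclose them give an annulus around the whole disc.\<close>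
    define r :: complex where "r = of_real (norm t)"
    have r: "norm r = norm t"
      by (simp add: r_def)
    have n: "norm (1 - r) = 1 - norm t" "norm (1 + r) = 1 + norm t"
      using t norm_of_real[of "1 - norm t", where 'a = complex]
        norm_of_real[of "1 + norm t", where 'a = complex] by (simp_all add: r_def)
    have "v \<noteq> 0 \<and> (x * v powi a, y * v powi b) \<in> H5_domain A B C"
      if "v \<in> {1, 1 - t, 1 - r, 1 + r}" for v
    proof -
      have "norm (1 - v) \<le> norm t"
        using that by (auto simp: r)
      then show ?thesis
        using dom[of "1 - v"] t by auto
    qed
    then obtain \<rho>\<^sub>1 \<rho>\<^sub>2 where \<rho>: "curve_radius A B C x y a b \<rho>\<^sub>1" "curve_radius A B C x y a b \<rho>\<^sub>2"
      and "\<forall>v\<in>{1, 1 - t, 1 - r, 1 + r}. \<rho>\<^sub>1 < norm v \<and> norm v < \<rho>\<^sub>2"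
      using curve_radius_around_finite[of "{1, 1 - t, 1 - r, 1 + r}" x a y b A B C] by blast
    then have "\<rho>\<^sub>1 < 1" "1 < \<rho>\<^sub>2" "\<rho>\<^sub>1 < norm (1 - t)" "norm (1 - t) < \<rho>\<^sub>2"
      "\<rho>\<^sub>1 < 1 - norm t" "1 + norm t < \<rho>\<^sub>2"
      by (auto simp: n)
    then show ?thesis
      unfolding lhs rhs_def
      by (intro binomial_resummation(1)[OF t _ _ _ _ _ _ _ coeff]) (use radius \<rho> in auto)
  qed
  show "lhs = (\<Sum>k. rhs k)" if "summable rhs"
  proof -
    have "v \<noteq> 0 \<and> (x * v powi a, y * v powi b) \<in> H5_domain A B C" if "v \<in> {1, 1 - t}" for v
      using that dom_1 dom_t one_minus_t by auto
    then obtain \<rho>\<^sub>1 \<rho>\<^sub>2 where \<rho>: "curve_radius A B C x y a b \<rho>\<^sub>1" "curve_radius A B C x y a b \<rho>\<^sub>2"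
      and "\<forall>v\<in>{1, 1 - t}. \<rho>\<^sub>1 < norm v \<and> norm v < \<rho>\<^sub>2"
      using curve_radius_around_finite[of "{1, 1 - t}" x a y b A B C] by blast
    then have "\<rho>\<^sub>1 < 1" "1 < \<rho>\<^sub>2" "\<rho>\<^sub>1 < norm (1 - t)" "norm (1 - t) < \<rho>\<^sub>2"
      by auto
    then show ?thesis
      using that unfolding lhs rhs_def
      by (intro binomial_resummation(2)[OF t _ _ _ _ _ _ _ coeff, symmetric]) (use radius \<rho> in auto)
  qed
qed

text \<open>Here the exponent is \<open>-(2m + n)\<close>, and the identity is \<open>(A + N)\<^sub>k (A)\<^sub>N = (A)\<^sub>k (A + k)\<^sub>N\<close> for
  \<open>N = 2m + n\<close>.\<close>
lemma horn_H5_term_shift_A: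
  fixes A B C :: "complex^'d^'d"
  shows "poch_nat (A - mat (of_int (- 2 * int m + - 1 * int n))) k ** horn_H5_term A B C x y m n
           = poch_nat A k ** horn_H5_term (A + mat (of_nat k)) B C x y m n"
proof -
  have "A - mat (of_int (- 2 * int m + - 1 * int n)) = A + mat (of_nat (2 * m + n))"
    by (simp add: vec_eq_iff mat_def)
  moreover have "poch X (2 * int m + int n) = poch_nat X (2 * m + n)" for X :: "complex^'d^'d"
    using poch_of_nat[of X "2 * m + n"] by simp
  ultimately show ?thesis
    by (simp only: horn_H5_term_def cscale_mult_right matrix_mul_assoc poch_nat_swap)
qed

text \<open>
  Here the exponent is \<open>m - n\<close>, and the factor \<open>(A)\<^sub>2\<^sub>m\<^sub>+\<^sub>n\<close> stands to the left of \<open>(B)\<^sub>n\<^sub>-\<^sub>m\<close>. As \<open>A\<close>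
  and \<open>B\<close> commute, \<open>(B + n - m)\<^sub>k\<close> can be moved past it to meet \<open>(B)\<^sub>n\<^sub>-\<^sub>m\<close>.
\<close>
lemma horn_H5_term_shift_B:
  fixes A B C :: "complex^'d^'d"
  assumes comm: "A ** B = B ** A"
    and below: "\<And>i. i \<ge> 1 \<Longrightarrow> invertible (B - mat (of_nat i))"
    and above: "\<And>i. invertible (B + mat (of_nat i))"
  shows "poch_nat (B - mat (of_int (1 * int m + - 1 * int n))) k ** horn_H5_term A B C x y m n
           = poch_nat B k ** horn_H5_term A (B + mat (of_nat k)) C x y m n"
proof -
  let ?j = "int n - int m"
  let ?N = "2 * m + n"
  let ?X = "matrix_inv (poch C (int n))"
  have B_shift: "B - mat (of_int (1 * int m + - 1 * int n)) = B + mat (of_int ?j)"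
    by (simp add: vec_eq_iff mat_def)
  have A_poch: "poch A (2 * int m + int n) = poch_nat A ?N"
    using poch_of_nat[of A ?N] by simp
  have pull: "poch_nat (B + mat c) k ** poch_nat A ?N = poch_nat A ?N ** poch_nat (B + mat c) k" for c
    by (intro poch_nat_commute commute_shift poch_nat_commute[symmetric] comm)
  have pull0: "poch_nat B k ** poch_nat A ?N = poch_nat A ?N ** poch_nat B k"
    by (intro poch_nat_commute poch_nat_commute[symmetric] comm)
  have "poch_nat (B + mat (of_int ?j)) k ** (poch_nat A ?N ** poch B ?j ** ?X)
      = poch_nat A ?N ** (poch_nat (B + mat (of_int ?j)) k ** poch B ?j) ** ?X"
    by (simp only: matrix_mul_assoc pull)
  also have "\<dots> = poch_nat A ?N ** (poch_nat B k ** poch (B + mat (of_nat k)) ?j) ** ?X"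
    by (simp only: poch_swap[OF below above])
  also have "\<dots> = poch_nat B k ** (poch_nat A ?N ** poch (B + mat (of_nat k)) ?j ** ?X)"
    by (simp only: matrix_mul_assoc pull0)
  finally show ?thesis
    by (simp only: horn_H5_term_def cscale_mult_right B_shift A_poch)
qed

theorem theorem5p8:
  fixes A B C :: "complex^'d^'d" and x y t :: complex
  assumes C_inv: "\<forall>k::nat. invertible (C + mat (of_nat k))"
    and B_def: "\<forall>k::nat. k \<ge> 1 \<longrightarrow> invertible (B - mat (of_nat k))"
    and t: "norm t < 1"
  shows
    "((\<forall>n::nat. (x, y) \<in> H5_domain (A + mat (of_nat n)) B C) \<and>
      (x / (1 - t)^2, y / (1 - t)) \<in> H5_domain A B C \<longrightarrow>
        (let lhs = one_minus_powr_neg t A ** horn_H5 A B C (x / (1 - t)^2) (y / (1 - t));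
             rhs = (\<lambda>n::nat. (t ^ n / fact n) \<star>
                      (poch A (int n) ** horn_H5 (A + mat (of_nat n)) B C x y))
         in ((\<forall>s. norm s \<le> norm t \<longrightarrow> (x / (1 - s)^2, y / (1 - s)) \<in> H5_domain A B C)
               \<longrightarrow> rhs sums lhs) \<and>
            (summable rhs \<longrightarrow> lhs = (\<Sum>n. rhs n))))
     \<and>
     (A ** B = B ** A \<and>
      (\<forall>k::nat. invertible (B + mat (of_nat k))) \<and>
      (\<forall>n::nat. (x, y) \<in> H5_domain A (B + mat (of_nat n)) C) \<and>
      (x * (1 - t), y / (1 - t)) \<in> H5_domain A B C \<longrightarrow>
        (let lhs = one_minus_powr_neg t B ** horn_H5 A B C (x * (1 - t)) (y / (1 - t));
             rhs = (\<lambda>n::nat. (t ^ n / fact n) \<star>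
                      (poch B (int n) ** horn_H5 A (B + mat (of_nat n)) C x y))
         in ((\<forall>s. norm s \<le> norm t \<longrightarrow> (x * (1 - s), y / (1 - s)) \<in> H5_domain A B C)
               \<longrightarrow> rhs sums lhs) \<and>
            (summable rhs \<longrightarrow> lhs = (\<Sum>n. rhs n))))"
    (is "(?hyp_A \<longrightarrow> ?concl_A) \<and> (?hyp_B \<longrightarrow> ?concl_B)")
proof (intro conjI impI)
  have square: "x / v ^ 2 = x * v powi (- 2)" for v
    by (simp add: power_int_minus divide_inverse)
  have recip: "y / v = y * v powi (- 1)" for v
    by (simp add: power_int_minus divide_inverse)
  have zero: "M + mat (of_nat 0) = M" for M :: "complex^'d^'d"
    by (simp add: vec_eq_iff mat_def)
  show ?concl_A if hyp: ?hyp_A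
  proof -
    have dom_n: "(x, y) \<in> H5_domain (A + mat (of_nat n)) B C" for n
      using hyp by blast
    have dom_t: "(x * (1 - t) powi (- 2), y * (1 - t) powi (- 1)) \<in> H5_domain A B C"
      using hyp by (simp only: square recip)
    note resum = horn_H5_resummation[OF t dom_n[of 0, unfolded zero] dom_t,
        of "\<lambda>n. A + mat (of_nat n)" "\<lambda>n. B", OF dom_n horn_H5_term_shift_A]
    show ?thesis
      unfolding Let_def poch_of_nat square recip
      by (intro conjI impI) (rule resum; blast)+
  qed
  show ?concl_B if hyp: ?hyp_B
  proof -
    have comm: "A ** B = B ** A" and above: "invertible (B + mat (of_nat n))" for n
      using hyp by blast+
    have below: "invertible (B - mat (of_nat n))" if "n \<ge> 1" for n
      using B_def that by blast
    have dom_n: "(x, y) \<in> H5_domain A (B + mat (of_nat n)) C" for n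
      using hyp by blast
    have dom_t: "(x * (1 - t) powi 1, y * (1 - t) powi (- 1)) \<in> H5_domain A B C"
      using hyp by (simp only: recip power_int_1_right)
    note resum = horn_H5_resummation[OF t dom_n[of 0, unfolded zero] dom_t,
        of "\<lambda>n. A" "\<lambda>n. B + mat (of_nat n)",
        OF dom_n horn_H5_term_shift_B[OF comm below above], unfolded power_int_1_right]
    show ?thesis
      unfolding Let_def poch_of_nat recip
      by (intro conjI impI) (rule resum; blast)+
  qed
qed

end
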